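(* Let $k\ge 1$. For $1\le i\le k$, let $M_i$ be an $n_i\times n_i$ complex matrix and let $u_i,v_i\in\mathbb{C}^{n_i}$ be arbitrary complex vectors. Let $\rho_{ij}\in\mathbb{C}$ be arbitrary for $1\le i,j\le k$ with $i\ne j$. For each $i$, let $\phi_i(\lambda)=\det(\lambda I_{n_i}-M_i)$ and $\Gamma_i(\lambda)=v_i^t(\lambda I_{n_i}-M_i)^{-1}u_i\in\mathbb{C}(\lambda)$, and assume that each $\Gamma_i$ is a nonzero element of $\mathbb{C}(\lambda)$. Let $A$ be the block matrix of order $n_1+\dots+n_k$ whose $(i,i)$ diagonal block is $M_i$ and whose $(i,j)$ off-diagonal block is $\rho_{ij}u_iv_j^t$ for $i\ne j$. Let $\widetilde A$ be the $k\times k$ matrix over $\mathbb{C}(\lambda)$ with diagonal entries $\widetilde A_{ii}=1/\Gamma_i(\lambda)$ and off-diagonal entries $\widetilde A_{ij}=-\rho_{ij}$ for $i\ne j$. Then, in $\mathbb{C}(\lambda)$, $$\det(\lambda I-A)=\Big(\prod_{i=1}^k\phi_i(\lambda)\Gamma_i(\lambda)\Big)\det(\widetilde A).$$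
   Context: $v^t$ denotes the non-conjugated transpose. $\mathbb{C}(\lambda)$ is the field of rational functions in $\lambda$ over $\mathbb{C}$. Over this field, $\lambda I-M$ is invertible for any complex square matrix $M$. *)

theory Defs
  imports
    "HOL-Computational_Algebra.Normalized_Fraction"
    "Jordan_Normal_Form.Char_Poly"
    "Jordan_Normal_Form.Gauss_Jordan_Elimination"
begin

type_synonym ratfun = "complex poly fract"

definition ratfun_const :: "complex \<Rightarrow> ratfun" where
  "ratfun_const c = to_fract [:c:]"

definition ratfun_var :: ratfun where
  "ratfun_var = to_fract [:0, 1:]"

definition lambda_minus :: "complex mat \<Rightarrow> ratfun mat" where
  "lambda_minus M = ratfun_var \<cdot>\<^sub>m 1\<^sub>m (dim_row M) - map_mat ratfun_const M"

definition phi :: "complex mat \<Rightarrow> ratfun" where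
  "phi M = det (lambda_minus M)"

text \<open>The operation \<open>\<bullet>\<close> on vectors is the non-conjugated product.  The option returned by
  \<open>mat_inverse\<close> is never \<open>None\<close> here: see \<open>mat_inverse_lambda_minus\<close> below.\<close>

definition Gamma_fun :: "complex mat \<Rightarrow> complex vec \<Rightarrow> complex vec \<Rightarrow> ratfun" where
  "Gamma_fun M u v =
     map_vec ratfun_const v \<bullet> (the (mat_inverse (lambda_minus M)) *\<^sub>v map_vec ratfun_const u)"

text \<open>Rows and columns of a \<open>k\<close> by \<open>k\<close> block matrix are enumerated by the pairs
  (block, position inside the block) in lexicographic order; blocks are numbered from \<open>0\<close>.\<close>

definition block_indices :: "nat \<Rightarrow> (nat \<Rightarrow> nat) \<Rightarrow> (nat \<times> nat) list" where
  "block_indices k n = concat (map (\<lambda>i. map (Pair i) [0..<n i]) [0..<k])"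

definition block_matrix :: "nat \<Rightarrow> (nat \<Rightarrow> nat) \<Rightarrow> (nat \<Rightarrow> nat \<Rightarrow> 'a mat) \<Rightarrow> 'a mat" where
  "block_matrix k n B = mat (\<Sum>i<k. n i) (\<Sum>i<k. n i)
     (\<lambda>(p, q). let (i, a) = block_indices k n ! p; (j, b) = block_indices k n ! q
               in B i j $$ (a, b))"

definition coupled_matrix ::
  "nat \<Rightarrow> (nat \<Rightarrow> nat) \<Rightarrow> (nat \<Rightarrow> complex mat) \<Rightarrow> (nat \<Rightarrow> complex vec) \<Rightarrow> (nat \<Rightarrow> complex vec)
   \<Rightarrow> (nat \<Rightarrow> nat \<Rightarrow> complex) \<Rightarrow> complex mat" where
  "coupled_matrix k n M u v \<rho> = block_matrix k n
     (\<lambda>i j. if i = j then M i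
            else \<rho> i j \<cdot>\<^sub>m (transpose_mat (mat_of_row (u i)) * mat_of_row (v j)))"

definition reduced_matrix ::
  "nat \<Rightarrow> (nat \<Rightarrow> complex mat) \<Rightarrow> (nat \<Rightarrow> complex vec) \<Rightarrow> (nat \<Rightarrow> complex vec)
   \<Rightarrow> (nat \<Rightarrow> nat \<Rightarrow> complex) \<Rightarrow> ratfun mat" where
  "reduced_matrix k M u v \<rho> = mat k k
     (\<lambda>(i, j). if i = j then 1 / Gamma_fun (M i) (u i) (v i) else - ratfun_const (\<rho> i j))"

lemma lambda_minus_carrier:
  "M \<in> carrier_mat m m \<Longrightarrow> lambda_minus M \<in> carrier_mat m m"
  by (auto simp: lambda_minus_def)

lemma lambda_minus_char_poly_matrix:
  assumes "M \<in> carrier_mat m m"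
  shows "lambda_minus M = map_mat to_fract (char_poly_matrix M)"
  by (rule eq_matI)
    (use assms in \<open>auto simp: lambda_minus_def char_poly_matrix_def ratfun_var_def ratfun_const_def
      simp flip: to_fract_add to_fract_uminus to_fract_diff\<close>)

lemma phi_eq_char_poly:
  assumes "M \<in> carrier_mat m m"
  shows "phi M = to_fract (char_poly M)"
proof -
  interpret comm_ring_hom "to_fract :: complex poly \<Rightarrow> _"
    by unfold_locales auto
  show ?thesis
    by (simp add: phi_def lambda_minus_char_poly_matrix[OF assms] char_poly_def)
qed

lemma mat_inverse_lambda_minus:
  assumes "M \<in> carrier_mat m m"
  obtains R where "mat_inverse (lambda_minus M) = Some R" "R \<in> carrier_mat m m"
    "lambda_minus M * R = 1\<^sub>m m" "R * lambda_minus M = 1\<^sub>m m"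
proof -
  have c: "lambda_minus M \<in> carrier_mat m m"
    using assms by (rule lambda_minus_carrier)
  have "char_poly M \<noteq> 0"
    using degree_monic_char_poly[OF assms] by auto
  hence "det (lambda_minus M) \<noteq> 0"
    using phi_eq_char_poly[OF assms] by (simp add: phi_def)
  hence "lambda_minus M \<in> Units (ring_mat TYPE(ratfun) m ())"
    by (rule det_non_zero_imp_unit[OF c])
  then obtain R where "mat_inverse (lambda_minus M) = Some R"
    using mat_inverse(1)[OF c, of "()"] by (cases "mat_inverse (lambda_minus M)") auto
  with mat_inverse(2)[OF c this] that show thesis by blast
qed

lemma length_block_indices: "length (block_indices k n) = (\<Sum>i<k. n i)"
  by (induction k) (simp_all add: block_indices_def)

lemma nth_block_indices:
  assumes "i < k" "a < n i"
  shows "block_indices k n ! ((\<Sum>l<i. n l) + a) = (i, a)"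
  using assms
proof (induction k)
  case (Suc k)
  have step: "block_indices (Suc k) n = block_indices k n @ map (Pair k) [0..<n k]"
    by (simp add: block_indices_def)
  show ?case
  proof (cases "i = k")
    case True
    with Suc.prems show ?thesis
      by (simp add: step nth_append length_block_indices)
  next
    case False
    with Suc.prems have i: "i < k" by simp
    have "(\<Sum>l<i. n l) + a < (\<Sum>l<Suc i. n l)" using Suc.prems by simp
    also have "\<dots> \<le> (\<Sum>l<k. n l)" by (rule sum_mono2) (use i in auto)
    finally show ?thesis
      using Suc.IH[OF i] Suc.prems by (simp add: step nth_append length_block_indices)
  qed
qed simp

lemma block_matrix_entry:
  assumes "i < k" "j < k" "a < n i" "b < n j"
  shows "block_matrix k n B $$ ((\<Sum>l<i. n l) + a, (\<Sum>l<j. n l) + b) = B i j $$ (a, b)"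
proof -
  have bound: "(\<Sum>l<i. n l) + a < (\<Sum>l<k. n l)" if "i < k" "a < n i" for i a
  proof -
    have "(\<Sum>l<i. n l) + a < (\<Sum>l<Suc i. n l)" using that by simp
    also have "\<dots> \<le> (\<Sum>l<k. n l)" by (rule sum_mono2) (use that in auto)
    finally show ?thesis .
  qed
  show ?thesis
    using assms bound by (simp add: block_matrix_def nth_block_indices)
qed

lemma rank_one_block_entry:
  assumes "a < dim_vec u" "b < dim_vec v"
  shows "(transpose_mat (mat_of_row u) * mat_of_row v) $$ (a, b) = u $ a * v $ b"
  using assms by (simp add: mat_of_row_def scalar_prod_def)

end

theory Submission
  imports Defs
begin

text \<open>Let \<open>D\<close> be the block diagonal matrix with blocks \<open>\<lambda>I - M\<^sub>i\<close>. Solving \<open>(\<lambda>I - M\<^sub>i) w\<^sub>i = u\<^sub>i\<close> turns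
  \<open>\<lambda>I - A\<close> into \<open>D (I - W Z)\<close>, where \<open>W\<close> has \<open>k\<close> columns, the \<open>i\<close>-th one being \<open>w\<^sub>i\<close> placed in
  block \<open>i\<close>, and \<open>Z\<close> has \<open>k\<close> rows, the \<open>i\<close>-th one having the blocks \<open>\<rho>\<^sub>i\<^sub>j v\<^sub>j\<close> (with \<open>\<rho>\<^sub>i\<^sub>i = 0\<close>).
  By Sylvester's identity \<open>det (I - W Z) = det (I - Z W)\<close>, and \<open>I - Z W\<close> is
  the reduced matrix times the diagonal matrix of the \<open>\<Gamma>\<^sub>i = v\<^sub>i \<bullet> w\<^sub>i\<close>.\<close>

section \<open>Sylvester's determinant identity\<close>

text \<open>Multiplying \<open>P\<close> by the unit lower triangular \<open>L\<close> on either
  side clears its lower left block. On the right this leaves \<open>1 - X * Y\<close> in the upper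
  left corner, on the left it leaves \<open>1 - Y * X\<close> in the lower right one, and
  \<open>P * L\<close> and \<open>L * P\<close> have the same determinant.\<close>

lemma det_one_minus_mult_commute:
  fixes X Y :: "'a :: idom mat"
  assumes X: "X \<in> carrier_mat n k" and Y: "Y \<in> carrier_mat k n"
  shows "det (1\<^sub>m n - X * Y) = det (1\<^sub>m k - Y * X)"
proof -
  define P where "P = four_block_mat (1\<^sub>m n) X Y (1\<^sub>m k)"
  define L where "L = four_block_mat (1\<^sub>m n) (0\<^sub>m n k) (- Y) (1\<^sub>m k)"
  have carrier: "P \<in> carrier_mat (n + k) (n + k)" "L \<in> carrier_mat (n + k) (n + k)"
    by (simp_all add: P_def L_def)
  have "det L = 1"
    unfolding L_def using Y by (subst det_four_block_mat_upper_right_zero) auto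
  have XY: "X * Y \<in> carrier_mat n n" and YX: "Y * X \<in> carrier_mat k k"
    using X Y by auto
  have mX: "X * - Y = - (X * Y)" and mY: "- Y * X = - (Y * X)"
    using X Y by auto
  have "P * L = four_block_mat (1\<^sub>m n - X * Y) X (0\<^sub>m k n) (1\<^sub>m k)"
    unfolding P_def L_def using X Y
    by (subst mult_four_block_mat[where ?nr1.0 = n and ?nr2.0 = k])
       (auto simp: mX add_uminus_minus_mat[OF _ XY] intro!: cong_four_block_mat)
  then have "det (P * L) = det (1\<^sub>m n - X * Y)"
    using det_four_block_mat_lower_left_zero[of "1\<^sub>m n - X * Y" n X k "0\<^sub>m k n" "1\<^sub>m k"] X XY
    by (simp add: minus_carrier_mat)
  moreover have "L * P = four_block_mat (1\<^sub>m n) X (0\<^sub>m k n) (1\<^sub>m k - Y * X)"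
    unfolding P_def L_def using X Y YX
    by (subst mult_four_block_mat[where ?nr1.0 = n and ?nr2.0 = k])
       (auto simp: mY intro!: cong_four_block_mat)
  then have "det (L * P) = det (1\<^sub>m k - Y * X)"
    using det_four_block_mat_lower_left_zero[of "1\<^sub>m n" n X k "0\<^sub>m k n" "1\<^sub>m k - Y * X"] X YX
    by (simp add: minus_carrier_mat)
  ultimately show ?thesis
    using carrier \<open>det L = 1\<close> by (simp add: det_mult)
qed

section \<open>Enumeration of rows and columns by pairs (block, position)\<close>

lemma block_indices_Suc: "block_indices (Suc k) n = block_indices k n @ map (Pair k) [0..<n k]"
  by (simp add: block_indices_def)

lemma set_block_indices: "set (block_indices k n) = Sigma {..<k} (\<lambda>i. {..<n i})"
  by (auto simp: block_indices_def)

lemma distinct_block_indices: "distinct (block_indices k n)"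
proof (induction k)
  case (Suc k)
  then show ?case
    by (auto simp: block_indices_Suc set_block_indices distinct_map inj_on_def)
qed (simp add: block_indices_def)

lemma block_indices_cases:
  assumes "p < (\<Sum>i<k. n i)"
  obtains i a where "block_indices k n ! p = (i, a)" "i < k" "a < n i"
proof -
  have "block_indices k n ! p \<in> set (block_indices k n)"
    using assms by (simp add: length_block_indices)
  then show thesis using that by (auto simp: set_block_indices)
qed

text \<open>Lets the inner index of a matrix product run block by block, so that factors supported
  in a single block collapse the outer sum.\<close>

lemma sum_block_indices:
  fixes g :: "nat \<times> nat \<Rightarrow> 'a :: comm_monoid_add"
  shows "(\<Sum>p<(\<Sum>i<k. n i). g (block_indices k n ! p)) = (\<Sum>i<k. \<Sum>a<n i. g (i, a))"
proof -
  have "(\<Sum>p<(\<Sum>i<k. n i). g (block_indices k n ! p)) = sum_list (map g (block_indices k n))"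
    by (simp add: sum_list_sum_nth length_block_indices atLeast0LessThan)
  also have "\<dots> = (\<Sum>i<k. \<Sum>a<n i. g (i, a))"
    by (induction k)
       (simp_all add: block_indices_Suc block_indices_def comp_def sum_list_distinct_conv_sum_set
          interv_sum_list_conv_sum_set_nat atLeast0LessThan)
  finally show ?thesis .
qed

lemma dim_block_matrix [simp]:
  "dim_row (block_matrix k n B) = (\<Sum>i<k. n i)" "dim_col (block_matrix k n B) = (\<Sum>i<k. n i)"
  by (simp_all add: block_matrix_def)

lemma block_matrix_carrier: "block_matrix k n B \<in> carrier_mat (\<Sum>i<k. n i) (\<Sum>i<k. n i)"
  by auto

lemma block_matrix_index:
  assumes "p < (\<Sum>i<k. n i)" "q < (\<Sum>i<k. n i)"
    and "block_indices k n ! p = (i, a)" "block_indices k n ! q = (j, b)"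
  shows "block_matrix k n B $$ (p, q) = B i j $$ (a, b)"
  using assms by (simp add: block_matrix_def)

section \<open>Determinants of block diagonal and rank-one coupled matrices\<close>

text \<open>Induction on the number of blocks: the last block is split off, and the zero block below
  the first \<open>k\<close> makes the determinant multiplicative.\<close>

lemma det_block_diagonal:
  fixes D :: "nat \<Rightarrow> 'a :: idom mat"
  assumes "\<And>i. i < k \<Longrightarrow> D i \<in> carrier_mat (n i) (n i)"
  shows "det (block_matrix k n (\<lambda>i j. if i = j then D i else 0\<^sub>m (n i) (n j))) = (\<Prod>i<k. det (D i))"
  using assms
proof (induction k)
  case 0
  have "block_matrix 0 n (\<lambda>i j. if i = j then D i else 0\<^sub>m (n i) (n j)) = 1\<^sub>m 0"
    by (intro eq_matI) auto
  then show ?case by simp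
next
  case (Suc k)
  let ?B = "\<lambda>i j. if i = j then D i else 0\<^sub>m (n i) (n j)"
  let ?N = "\<Sum>i<k. n i"
  have Dk: "D k \<in> carrier_mat (n k) (n k)" using Suc.prems by simp
  have index: "block_indices (Suc k) n ! p =
      (if p < ?N then block_indices k n ! p else (k, p - ?N))" if "p < ?N + n k" for p
    using that by (auto simp: block_indices_Suc nth_append length_block_indices)
  have "block_matrix (Suc k) n ?B =
      four_block_mat (block_matrix k n ?B) (0\<^sub>m ?N (n k)) (0\<^sub>m (n k) ?N) (D k)"
  proof (rule eq_matI)
    fix p q
    assume "p < dim_row (four_block_mat (block_matrix k n ?B) (0\<^sub>m ?N (n k)) (0\<^sub>m (n k) ?N) (D k))"
      and "q < dim_col (four_block_mat (block_matrix k n ?B) (0\<^sub>m ?N (n k)) (0\<^sub>m (n k) ?N) (D k))"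
    then have p: "p < ?N + n k" and q: "q < ?N + n k" using Dk by auto
    \<comment> \<open>Positions before \<open>?N\<close> belong to blocks with number below
      \<open>k\<close>, hence different from \<open>k\<close>; this makes the mixed entries
      zero.\<close>
    have old: "\<exists>i a. block_indices k n ! r = (i, a) \<and> i < k \<and> a < n i" if "r < ?N" for r
      using block_indices_cases[OF that] by metis
    show "block_matrix (Suc k) n ?B $$ (p, q) =
      four_block_mat (block_matrix k n ?B) (0\<^sub>m ?N (n k)) (0\<^sub>m (n k) ?N) (D k) $$ (p, q)"
      using p q Dk old[of p] old[of q]
      by (cases "p < ?N"; cases "q < ?N") (auto simp: block_matrix_def index)
  qed (use Dk in auto)
  then show ?case
    using Suc Dk
    by (simp add: det_four_block_mat_lower_left_zero[OF block_matrix_carrier zero_carrier_mat refl Dk])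
qed

text \<open>The identity over an arbitrary field, with \<open>D i\<close> in the role of \<lambda>I
  - M_i. The vector u_i is written as \<open>D i\<close> applied to \<open>w i\<close>, so that
  \<open>D i\<close> can be factored out on the left without mentioning an inverse.\<close>

lemma det_rank_one_coupled_blocks:
  fixes D :: "nat \<Rightarrow> 'a :: field mat" and v w :: "nat \<Rightarrow> 'a vec" and r :: "nat \<Rightarrow> nat \<Rightarrow> 'a"
  assumes D: "\<And>i. i < k \<Longrightarrow> D i \<in> carrier_mat (n i) (n i)"
    and w: "\<And>i. i < k \<Longrightarrow> w i \<in> carrier_vec (n i)"
    and nonzero: "\<And>i. i < k \<Longrightarrow> v i \<bullet> w i \<noteq> 0"
  shows "det (block_matrix k n (\<lambda>i j. if i = j then D i
        else mat (n i) (n j) (\<lambda>(a, b). - (r i j * (D i *\<^sub>v w i) $ a * v j $ b)))) =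
    (\<Prod>i<k. det (D i) * (v i \<bullet> w i)) *
      det (mat k k (\<lambda>(i, j). if i = j then 1 / (v i \<bullet> w i) else - r i j))"
    (is "det ?T = _ * det ?R")
proof -
  let ?N = "\<Sum>i<k. n i"
  let ?idx = "\<lambda>p. block_indices k n ! p"
  \<comment> \<open>Zero self-coupling makes the diagonal blocks of \<open>U * Z\<close> vanish, so
    that subtracting it leaves each \<open>D i\<close> intact; it also makes the diagonal of
    \<open>Z * W\<close> vanish.\<close>
  define r' where "r' i j = (if i = j then 0 else r i j)" for i j
  define \<D> where "\<D> = block_matrix k n (\<lambda>i j. if i = j then D i else 0\<^sub>m (n i) (n j))"
  define W where "W = mat ?N k (\<lambda>(p, j). case ?idx p of (i, a) \<Rightarrow> if i = j then w i $ a else 0)"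
  define U where "U = mat ?N k (\<lambda>(p, j). case ?idx p of (i, a) \<Rightarrow> if i = j then (D i *\<^sub>v w i) $ a else 0)"
  define Z where "Z = mat k ?N (\<lambda>(j, q). case ?idx q of (l, b) \<Rightarrow> r' j l * v l $ b)"
  define G where "G = mat k k (\<lambda>(i, j). if i = j then v i \<bullet> w i else 0)"
  have carrier: "\<D> \<in> carrier_mat ?N ?N" "W \<in> carrier_mat ?N k" "U \<in> carrier_mat ?N k"
      "Z \<in> carrier_mat k ?N" "G \<in> carrier_mat k k" "?R \<in> carrier_mat k k"
    by (auto simp: \<D>_def W_def U_def Z_def G_def)
  have DW: "\<D> * W = U"
  proof (rule eq_matI)
    fix p j assume "p < dim_row U" "j < dim_col U"
    then have p: "p < ?N" and j: "j < k" using carrier by auto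
    obtain i a where ia: "?idx p = (i, a)" "i < k" "a < n i"
      using block_indices_cases[OF p] .
    have "(\<D> * W) $$ (p, j) = (\<Sum>q<?N. \<D> $$ (p, q) * W $$ (q, j))"
      using p j carrier by (simp add: scalar_prod_def atLeast0LessThan)
    also have "\<dots> = (\<Sum>q<?N. case ?idx q of (l, b) \<Rightarrow>
        (if i = l then D i else 0\<^sub>m (n i) (n l)) $$ (a, b) * (if l = j then w l $ b else 0))"
      using p j ia by (intro sum.cong) (auto simp: \<D>_def W_def block_matrix_def split: prod.split)
    also have "\<dots> = (\<Sum>l<k. \<Sum>b<n l.
        (if i = l then D i else 0\<^sub>m (n i) (n l)) $$ (a, b) * (if l = j then w l $ b else 0))"
      by (subst sum_block_indices) simp
    also have "\<dots> = (\<Sum>l<k. if l = j then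
        (\<Sum>b<n l. (if i = l then D i else 0\<^sub>m (n i) (n l)) $$ (a, b) * w l $ b) else 0)"
      by (intro sum.cong) auto
    also have "\<dots> = (\<Sum>b<n j. (if i = j then D i else 0\<^sub>m (n i) (n j)) $$ (a, b) * w j $ b)"
      using j by simp
    \<comment> \<open>For \<open>i = j\<close> the sum is entry \<open>a\<close> of
      \<open>D i\<close> times \<open>w i\<close>; for \<open>i \<noteq> j\<close> it runs over a
      row of a zero block.\<close>
    also have "\<dots> = U $$ (p, j)"
      using p j ia D[of i] w[of i]
      by (auto simp: U_def scalar_prod_def atLeast0LessThan intro!: sum.cong)
    finally show "(\<D> * W) $$ (p, j) = U $$ (p, j)" .
  qed (use carrier in auto)
  have T: "?T = \<D> - U * Z"
  proof (rule eq_matI)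
    fix p q assume "p < dim_row (\<D> - U * Z)" "q < dim_col (\<D> - U * Z)"
    then have p: "p < ?N" and q: "q < ?N" using carrier by auto
    obtain i a where ia: "?idx p = (i, a)" "i < k" "a < n i"
      using block_indices_cases[OF p] .
    obtain j b where jb: "?idx q = (j, b)" "j < k" "b < n j"
      using block_indices_cases[OF q] .
    have "(U * Z) $$ (p, q) = (\<Sum>l<k. U $$ (p, l) * Z $$ (l, q))"
      using p q carrier by (simp add: scalar_prod_def atLeast0LessThan)
    \<comment> \<open>Row \<open>p\<close> of \<open>U\<close> lies in block \<open>i\<close>, so
      its only possibly nonzero entry is in column \<open>i\<close>.\<close>
    also have "\<dots> = (\<Sum>l<k. if l = i then (D i *\<^sub>v w i) $ a * (r' i j * v j $ b) else 0)"
      using p q ia jb by (intro sum.cong) (auto simp: U_def Z_def)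
    finally have "(U * Z) $$ (p, q) = r' i j * (D i *\<^sub>v w i) $ a * v j $ b"
      using ia by simp
    then show "?T $$ (p, q) = (\<D> - U * Z) $$ (p, q)"
      using p q ia jb carrier by (auto simp: \<D>_def block_matrix_def r'_def)
  qed (use carrier in auto)
  \<comment> \<open>Together with \<open>\<D> * W = U\<close> this pulls the block diagonal factor
    out of \<open>\<D> - U * Z\<close>.\<close>
  have "\<D> * (1\<^sub>m ?N - W * Z) = \<D> * 1\<^sub>m ?N - \<D> * (W * Z)"
    using carrier by (intro mult_minus_distrib_mat) auto
  then have factor: "?T = \<D> * (1\<^sub>m ?N - W * Z)"
    using carrier by (simp add: T flip: DW)
  \<comment> \<open>Right multiplication by \<open>G\<close> scales column \<open>j\<close> by
    \<open>v j \<bullet> w j\<close>. On the diagonal this cancels the reciprocal, which is where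
    \<open>nonzero\<close> enters; elsewhere it gives the entries of
    \<open>- (Z * W)\<close>.\<close>
  have reduced: "1\<^sub>m k - Z * W = ?R * G"
  proof (rule eq_matI)
    fix i j assume "i < dim_row (?R * G)" "j < dim_col (?R * G)"
    then have i: "i < k" and j: "j < k" using carrier by auto
    have "(Z * W) $$ (i, j) = (\<Sum>q<?N. Z $$ (i, q) * W $$ (q, j))"
      using i j carrier by (simp add: scalar_prod_def atLeast0LessThan)
    also have "\<dots> = (\<Sum>q<?N. case ?idx q of (l, b) \<Rightarrow>
        r' i l * v l $ b * (if l = j then w l $ b else 0))"
      using i j by (intro sum.cong) (auto simp: Z_def W_def split: prod.split)
    also have "\<dots> = (\<Sum>l<k. \<Sum>b<n l. r' i l * v l $ b * (if l = j then w l $ b else 0))"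
      by (subst sum_block_indices) simp
    also have "\<dots> = (\<Sum>l<k. if l = j then r' i l * (\<Sum>b<n l. v l $ b * w l $ b) else 0)"
      by (intro sum.cong) (auto simp: sum_distrib_left mult.assoc)
    also have "\<dots> = r' i j * (v j \<bullet> w j)"
      using j w[of j] by (simp add: scalar_prod_def atLeast0LessThan)
    finally have ZW: "(Z * W) $$ (i, j) = r' i j * (v j \<bullet> w j)" .
    have "(?R * G) $$ (i, j) = (\<Sum>l<k. ?R $$ (i, l) * G $$ (l, j))"
      using i j carrier by (simp add: scalar_prod_def atLeast0LessThan)
    also have "\<dots> = (\<Sum>l<k. if l = j then ?R $$ (i, l) * (v j \<bullet> w j) else 0)"
      using i j by (intro sum.cong) (auto simp: G_def)
    finally have "(?R * G) $$ (i, j) = ?R $$ (i, j) * (v j \<bullet> w j)"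
      using j by simp
    then show "(1\<^sub>m k - Z * W) $$ (i, j) = (?R * G) $$ (i, j)"
      using i j ZW nonzero carrier by (auto simp: r'_def)
  qed (use carrier in auto)
  have "det G = (\<Prod>i<k. v i \<bullet> w i)"
  proof -
    have "det G = prod_list (diag_mat G)"
      using carrier by (intro det_upper_triangular) (auto simp: G_def)
    then show ?thesis
      by (simp add: diag_mat_def G_def prod.list_conv_set_nth atLeast0LessThan)
  qed
  moreover have "det ?T = det \<D> * det (1\<^sub>m ?N - W * Z)"
    unfolding factor using carrier by (intro det_mult) auto
  moreover have "det (1\<^sub>m ?N - W * Z) = det ?R * det G"
    unfolding det_one_minus_mult_commute[OF carrier(2,4)] reduced
    using carrier(6,5) by (rule det_mult)
  moreover have "det \<D> = (\<Prod>i<k. det (D i))"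
    unfolding \<D>_def using D by (rule det_block_diagonal)
  ultimately show ?thesis
    by (simp add: prod.distrib)
qed

section \<open>Specialisation to \<lambda>I - A over the rational functions\<close>

lemma ratfun_const_mult: "ratfun_const (a * b) = ratfun_const a * ratfun_const b"
  by (simp add: ratfun_const_def flip: to_fract_mult)

lemma lambda_minus_index:
  assumes "M \<in> carrier_mat m m" "p < m" "q < m"
  shows "lambda_minus M $$ (p, q) = (if p = q then ratfun_var else 0) - ratfun_const (M $$ (p, q))"
  using assms by (simp add: lambda_minus_def)

text \<open>The variable occurs only on the main diagonal, which meets only the diagonal blocks and
  is the main diagonal of each of them. Off-diagonal blocks therefore just change sign.\<close>

lemma lambda_minus_coupled_matrix:
  assumes M: "\<And>i. i < k \<Longrightarrow> M i \<in> carrier_mat (n i) (n i)"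
    and u: "\<And>i. i < k \<Longrightarrow> u i \<in> carrier_vec (n i)"
    and v: "\<And>i. i < k \<Longrightarrow> v i \<in> carrier_vec (n i)"
  shows "lambda_minus (coupled_matrix k n M u v \<rho>) =
    block_matrix k n (\<lambda>i j. if i = j then lambda_minus (M i)
      else mat (n i) (n j) (\<lambda>(a, b). - (ratfun_const (\<rho> i j) *
        map_vec ratfun_const (u i) $ a * map_vec ratfun_const (v j) $ b)))"
    (is "?L = ?R")
proof -
  let ?N = "\<Sum>i<k. n i"
  let ?A = "coupled_matrix k n M u v \<rho>"
  have A: "?A \<in> carrier_mat ?N ?N"
    by (simp add: coupled_matrix_def block_matrix_carrier)
  show ?thesis
  proof (rule eq_matI)
    fix p q assume "p < dim_row ?R" "q < dim_col ?R"
    then have p: "p < ?N" and q: "q < ?N" by auto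
    obtain i a where ia: "block_indices k n ! p = (i, a)" "i < k" "a < n i"
      using block_indices_cases[OF p] .
    obtain j b where jb: "block_indices k n ! q = (j, b)" "j < k" "b < n j"
      using block_indices_cases[OF q] .
    \<comment> \<open>No pair is enumerated twice, so being on the main diagonal can be read off
      from the pairs.\<close>
    have "p = q \<longleftrightarrow> i = j \<and> a = b"
      using nth_eq_iff_index_eq[OF distinct_block_indices[of k n], of p q] p q ia jb
      by (simp add: length_block_indices)
    moreover have "?L $$ (p, q) = (if p = q then ratfun_var else 0) - ratfun_const (?A $$ (p, q))"
      using A p q by (rule lambda_minus_index)
    moreover have "?A $$ (p, q) = (if i = j then M i $$ (a, b) else \<rho> i j * (u i $ a * v j $ b))"
      using ia jb u[of i] v[of j]
      by (auto simp: coupled_matrix_def block_matrix_index[OF p q ia(1) jb(1)] rank_one_block_entry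
          simp del: index_mult_mat(1))
    ultimately show "?L $$ (p, q) = ?R $$ (p, q)"
      using ia jb u[of i] v[of j]
      by (auto simp: lambda_minus_index[OF M] block_matrix_index[OF p q ia(1) jb(1)]
          ratfun_const_mult)
  qed (use lambda_minus_carrier[OF A] in auto)
qed

theorem theorem2p5:
  fixes k :: nat
    and n :: "nat \<Rightarrow> nat"
    and M :: "nat \<Rightarrow> complex mat"
    and u v :: "nat \<Rightarrow> complex vec"
    and \<rho> :: "nat \<Rightarrow> nat \<Rightarrow> complex"
  assumes "k \<ge> 1"
    and "\<And>i. i < k \<Longrightarrow> M i \<in> carrier_mat (n i) (n i)"
    and "\<And>i. i < k \<Longrightarrow> u i \<in> carrier_vec (n i)"
    and "\<And>i. i < k \<Longrightarrow> v i \<in> carrier_vec (n i)"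
    and "\<And>i. i < k \<Longrightarrow> Gamma_fun (M i) (u i) (v i) \<noteq> 0"
  shows "det (lambda_minus (coupled_matrix k n M u v \<rho>)) =
    (\<Prod>i<k. phi (M i) * Gamma_fun (M i) (u i) (v i)) * det (reduced_matrix k M u v \<rho>)"
proof -
  \<comment> \<open>The solution of (\<lambda>I - M_i) w_i = u_i over the rational functions. For
    \<open>i < k\<close> the inverse exists, so \<open>the\<close> is applied to a genuine
    value.\<close>
  define w where "w i = the (mat_inverse (lambda_minus (M i))) *\<^sub>v map_vec ratfun_const (u i)" for i
  have w: "w i \<in> carrier_vec (n i) \<and> lambda_minus (M i) *\<^sub>v w i = map_vec ratfun_const (u i)"
    if i: "i < k" for i
  proof -
    obtain R where R: "mat_inverse (lambda_minus (M i)) = Some R" "R \<in> carrier_mat (n i) (n i)"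
      "lambda_minus (M i) * R = 1\<^sub>m (n i)"
      using mat_inverse_lambda_minus[OF assms(2)[OF i]] .
    have u: "map_vec ratfun_const (u i) \<in> carrier_vec (n i)"
      using assms(3)[OF i] by simp
    have "lambda_minus (M i) *\<^sub>v w i = (lambda_minus (M i) * R) *\<^sub>v map_vec ratfun_const (u i)"
      using assoc_mult_mat_vec[OF lambda_minus_carrier[OF assms(2)[OF i]] R(2) u] R(1)
      by (simp add: w_def)
    then have "lambda_minus (M i) *\<^sub>v w i = map_vec ratfun_const (u i)"
      using u by (simp only: R(3) one_mult_mat_vec)
    then show ?thesis
      using R(1,2) u by (simp add: w_def)
  qed
  have Gamma: "Gamma_fun (M i) (u i) (v i) = map_vec ratfun_const (v i) \<bullet> w i" for i
    by (simp add: Gamma_fun_def w_def)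
  let ?T = "\<lambda>x. block_matrix k n (\<lambda>i j. if i = j then lambda_minus (M i)
      else mat (n i) (n j) (\<lambda>(a, b). - (ratfun_const (\<rho> i j) * x i $ a *
        map_vec ratfun_const (v j) $ b)))"
  \<comment> \<open>The two vectors are known to agree only for \<open>i < k\<close>; the
    enumeration reaches no other block, so the matrices agree entrywise.\<close>
  have "?T (\<lambda>i. map_vec ratfun_const (u i)) = ?T (\<lambda>i. lambda_minus (M i) *\<^sub>v w i)"
    unfolding block_matrix_def
    by (rule cong_mat) (auto simp: w elim!: block_indices_cases)
  then have "lambda_minus (coupled_matrix k n M u v \<rho>) = ?T (\<lambda>i. lambda_minus (M i) *\<^sub>v w i)"
    using lambda_minus_coupled_matrix[OF assms(2-4)] by simp
  then show ?thesis
    unfolding reduced_matrix_def phi_def Gamma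
    using det_rank_one_coupled_blocks[of k "\<lambda>i. lambda_minus (M i)" n w
        "\<lambda>i. map_vec ratfun_const (v i)" "\<lambda>i j. ratfun_const (\<rho> i j)"]
      lambda_minus_carrier[OF assms(2)] w assms(5)
    by (simp add: Gamma)
qed

end
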